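(* Let $p=p_n\in(0,1)$ and let $x=x_n$ be non-negative integers such that, as $n\to\infty$, $p\to0$, $np\to\infty$ and $|x-np^2|=o\big(\min(np^2,\,n^{2/3}p^{2/3})\big)$. Then $$\frac{P(S_\xi=x)}{\mathrm{NB}(r,\bar q)\{x\}}=1+o(1)\quad(n\to\infty).$$
   Context: $\eta_1,\dots,\eta_{n+1}$ are i.i.d. Bernoulli random variables with $P(\eta_1=1)=p=1-P(\eta_1=0)$; $\xi_i=\eta_i\eta_{i+1}$ and $S_\xi=\xi_1+\dots+\xi_n$ (the 2-runs statistic). The negative binomial distribution is $\mathrm{NB}(r,\bar q)\{j\}=\frac{\Gamma(r+j)}{j!\,\Gamma(r)}\bar q^r\bar p^j$, $j=0,1,2,\dots$, where $\bar q+\bar p=1$, with parameters $$\bar p=\frac{np^3(2-3p)-2p^3(1-p)}{np^2+np^3(2-3p)-2p^3(1-p)},\qquad r=\frac{n^2p^4}{np^3(2-3p)-2p^3(1-p)}.$$ *)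

theory Defs
  imports "HOL-Probability.Probability" "HOL-Library.Landau_Symbols"
begin

definition eta_pmf :: "nat \<Rightarrow> real \<Rightarrow> (nat \<Rightarrow> bool) pmf" where
  "eta_pmf n p = Pi_pmf {1..n+1} False (\<lambda>_. bernoulli_pmf p)"

definition S_xi :: "nat \<Rightarrow> (nat \<Rightarrow> bool) \<Rightarrow> nat" where
  "S_xi n eta = (\<Sum>i=1..n. (if eta i then 1 else 0) * (if eta (Suc i) then 1 else 0))"

definition prob_S :: "nat \<Rightarrow> real \<Rightarrow> nat \<Rightarrow> real" where
  "prob_S n p x = measure_pmf.prob (eta_pmf n p) {eta. S_xi n eta = x}"

definition NB :: "real \<Rightarrow> real \<Rightarrow> nat \<Rightarrow> real" where
  "NB r qbar j = Gamma (r + real j) / (fact j * Gamma r) * qbar powr r * (1 - qbar) ^ j"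

definition nb_pbar :: "nat \<Rightarrow> real \<Rightarrow> real" where
  "nb_pbar n p = (real n * p^3 * (2 - 3*p) - 2 * p^3 * (1 - p)) /
     (real n * p^2 + real n * p^3 * (2 - 3*p) - 2 * p^3 * (1 - p))"

definition nb_qbar :: "nat \<Rightarrow> real \<Rightarrow> real" where
  "nb_qbar n p = 1 - nb_pbar n p"

definition nb_r :: "nat \<Rightarrow> real \<Rightarrow> real" where
  "nb_r n p = (real n)^2 * p^4 / (real n * p^3 * (2 - 3*p) - 2 * p^3 * (1 - p))"

end

theory Submission
  imports Defs
begin

text \<open>
  The generating function of the 2-runs statistic comes from a linear recurrence with characteristic
  roots \<open>1 + w\<close> and \<open>p u - w\<close>, where \<open>u = z - 1\<close>; up to a factor \<open>1 + O(p\<^sup>3)\<close> it equals \<open>(1 + w)\<^sup>n\<close>.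
  The negative binomial generating function is \<open>(1 - b u) powr -r\<close> with \<open>b = pbar / qbar\<close> and
  \<open>r b = n p\<^sup>2\<close>. Matching mean and variance makes the two logarithms agree up to
  \<open>O(n p\<^sup>4 |u|\<^sup>3 + p\<^sup>3)\<close>. Both point probabilities are coefficients of these functions,
  so their difference is an integral over a circle \<open>|z| = \<rho>\<close>. The radius \<open>\<rho>\<close> is chosen such that the
  exponentially tilted negative binomial law has mean \<open>x\<close>: then \<open>\<rho> - 1\<close> has size
  \<open>|x - n p\<^sup>2| / (n p\<^sup>2)\<close>, the modulus on the circle decays like a Gaussian of width \<open>(n p\<^sup>2) powr -1/2\<close>,
  and the tilted point probability at \<open>x\<close> is at least a constant times \<open>(n p\<^sup>2) powr -1/2\<close>.
  The relative error is therefore \<open>O(|x - n p\<^sup>2|\<^sup>3 / (n p)\<^sup>2 + p\<^sup>2)\<close>.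
\<close>

section \<open>The generating function of the 2-runs statistic\<close>

lemma eta_pmf_Suc:
  "eta_pmf (Suc n) p =
    map_pmf (\<lambda>(y, f). f(Suc (Suc n) := y)) (pair_pmf (bernoulli_pmf p) (eta_pmf n p))"
proof -
  have "{1..Suc n + 1} = insert (Suc (Suc n)) {1..n + 1}" by auto
  then show ?thesis
    unfolding eta_pmf_def by (simp add: Pi_pmf_insert)
qed

lemma finite_set_eta_pmf: "finite (set_pmf (eta_pmf n p))"
proof (induction n)
  case 0
  show ?case by (simp add: eta_pmf_def Pi_pmf_singleton)
next
  case (Suc n)
  then show ?case by (simp add: eta_pmf_Suc)
qed

text \<open>Conditioning on the last coin. The values lie in a general normed field because the
  recurrence for the generating function has a complex variable.\<close>

lemma expectation_eta_pmf_Suc: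
  fixes f :: "(nat \<Rightarrow> bool) \<Rightarrow> 'a :: {banach, second_countable_topology, real_normed_field}"
  assumes "0 \<le> p" "p \<le> 1"
  shows "measure_pmf.expectation (eta_pmf (Suc n) p) f =
     of_real p * measure_pmf.expectation (eta_pmf n p) (\<lambda>e. f (e(Suc (Suc n) := True)))
     + of_real (1 - p) * measure_pmf.expectation (eta_pmf n p) (\<lambda>e. f (e(Suc (Suc n) := False)))"
proof -
  have *: "eta_pmf (Suc n) p =
      bernoulli_pmf p \<bind> (\<lambda>y. map_pmf (\<lambda>e. e(Suc (Suc n) := y)) (eta_pmf n p))"
    by (simp add: eta_pmf_Suc pair_pmf_def map_pmf_def bind_assoc_pmf bind_return_pmf)
  show ?thesis
    unfolding * using assms
    by (subst pmf_expectation_bind[where A = UNIV])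
       (auto simp: finite_set_eta_pmf UNIV_bool scaleR_conv_of_real)
qed

lemma S_xi_Suc:
  "S_xi (Suc n) (e(Suc (Suc n) := b)) = S_xi n e + (if e (Suc n) \<and> b then 1 else 0)"
  by (auto simp: S_xi_def intro!: sum.cong)

lemma S_xi_le: "S_xi n e \<le> n"
proof -
  have "S_xi n e \<le> (\<Sum>i=1..n. 1)" unfolding S_xi_def by (intro sum_mono) auto
  then show ?thesis by simp
qed

lemma prob_S_eq_0: "n < j \<Longrightarrow> prob_S n p j = 0"
  using S_xi_le[of n] by (auto simp: prob_S_def measure_pmf_zero_iff not_le[symmetric])

lemma sum_prob_S_power:
  "(\<Sum>j\<le>n. of_real (prob_S n p j) * z ^ j) =
    measure_pmf.expectation (eta_pmf n p) (\<lambda>e. (z :: complex) ^ S_xi n e)"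
proof -
  have "of_real (prob_S n p j) * z ^ j =
      measure_pmf.expectation (eta_pmf n p) (\<lambda>e. indicator {e. S_xi n e = j} e *\<^sub>R z ^ j)" for j
    by (subst integral_scaleR_left)
       (auto simp: prob_S_def scaleR_conv_of_real
             intro!: integrable_measure_pmf_finite finite_set_eta_pmf)
  then have "(\<Sum>j\<le>n. of_real (prob_S n p j) * z ^ j) =
     measure_pmf.expectation (eta_pmf n p) (\<lambda>e. \<Sum>j\<le>n. indicator {e. S_xi n e = j} e *\<^sub>R z ^ j)"
    by (subst Bochner_Integration.integral_sum)
       (auto intro!: integrable_measure_pmf_finite finite_set_eta_pmf)
  also have "\<dots> = measure_pmf.expectation (eta_pmf n p) (\<lambda>e. z ^ S_xi n e)"
    by (intro Bochner_Integration.integral_cong refl)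
       (use S_xi_le in \<open>auto simp: indicator_def of_bool_def if_distrib[of "\<lambda>x. x *\<^sub>R _"] cong: if_cong\<close>)
  finally show ?thesis .
qed

text \<open>Adding one coin acts linearly on the pair \<open>T\<close>, \<open>B\<close> below, by a
  matrix with trace \<open>1 + p * (z - 1)\<close> and determinant
  \<open>p * (1 - p) * (z - 1)\<close>; \<open>m1\<close> and \<open>m2\<close> are its eigenvalues.
  The conditions on \<open>c1\<close> and \<open>c2\<close> make
  \<open>c1 * m1 ^ k + c2 * m2 ^ k\<close> equal to 1 at \<open>k = 0\<close> and
  \<open>k = 1\<close>. The index is shifted by one: \<open>n = 0\<close> (one coin, empty sum)
  belongs to \<open>k = 1\<close>.\<close>

lemma gf_S_xi:
  fixes z c1 c2 m1 m2 :: complex and p :: real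
  assumes p: "0 \<le> p" "p \<le> 1"
    and "m1 + m2 = 1 + p * (z - 1)" "m1 * m2 = p * (1 - p) * (z - 1)"
    and "c1 + c2 = 1" "c1 * m1 + c2 * m2 = 1"
  shows "(\<Sum>j\<le>n. of_real (prob_S n p j) * z ^ j) = c1 * m1 ^ (n + 1) + c2 * m2 ^ (n + 1)"
proof -
  let ?E = "\<lambda>n. measure_pmf.expectation (eta_pmf n p)"
  define T where "T = (\<lambda>n. ?E n (\<lambda>e. z ^ S_xi n e))"
  \<comment> \<open>\<open>B\<close> restricts the expectation to a last coin showing 1, the only
    feature of the past that the next product sees.\<close>
  define B where "B = (\<lambda>n. ?E n (\<lambda>e. if e (Suc n) then z ^ S_xi n e else 0))"
  have int: "integrable (measure_pmf (eta_pmf n p)) f" for n and f :: "_ \<Rightarrow> complex"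
    by (intro integrable_measure_pmf_finite finite_set_eta_pmf)
  have z_if: "?E n (\<lambda>e. z ^ S_xi (Suc n) (e(Suc (Suc n) := True))) = T n + (z - 1) * B n" for n
  proof -
    have "?E n (\<lambda>e. z ^ S_xi (Suc n) (e(Suc (Suc n) := True))) =
      ?E n (\<lambda>e. z ^ S_xi n e + (z - 1) * (if e (Suc n) then z ^ S_xi n e else 0))"
      unfolding S_xi_Suc
      by (intro Bochner_Integration.integral_cong refl) (auto simp: algebra_simps)
    then show ?thesis by (simp add: T_def B_def int)
  qed
  have T_Suc: "T (Suc n) = T n + p * (z - 1) * B n" for n
  proof -
    have "T (Suc n) = p * (T n + (z - 1) * B n) + (1 - p) * T n"
      using z_if[of n] unfolding T_def expectation_eta_pmf_Suc[OF p]
      by (simp add: S_xi_Suc)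
    then show ?thesis by (simp add: algebra_simps)
  qed
  have B_Suc: "B (Suc n) = p * (T n + (z - 1) * B n)" for n
    unfolding z_if[symmetric] unfolding B_def expectation_eta_pmf_Suc[OF p] by simp
  have S0: "S_xi 0 e = 0" for e by (simp add: S_xi_def)
  have T0: "T 0 = 1" by (simp add: T_def S0)
  have B0: "B 0 = p"
    using p unfolding B_def S0
    by (simp add: eta_pmf_def Pi_pmf_singleton, subst integral_measure_pmf[of UNIV])
       (auto simp: UNIV_bool scaleR_conv_of_real)
  have char: "m * (m - 1) = p * (z - 1) * (p + (m - 1))" if "m = m1 \<or> m = m2" for m :: complex
  proof -
    have "(m - m1) * (m - m2) = 0" using that by auto
    then have "m * m - (m1 + m2) * m + m1 * m2 = 0" by (simp add: algebra_simps)
    then show ?thesis unfolding assms(3,4) by (simp add: algebra_simps)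
  qed
  \<comment> \<open>The induction carries \<open>p * (z - 1) * B n\<close> instead of
    \<open>B n\<close>, which avoids dividing by \<open>p * (z - 1)\<close>, a number that may
    vanish.\<close>
  have "T n = c1 * m1 ^ (n + 1) + c2 * m2 ^ (n + 1) \<and>
     p * (z - 1) * B n = c1 * m1 ^ (n + 1) * (m1 - 1) + c2 * m2 ^ (n + 1) * (m2 - 1)"
  proof (induction n)
    case 0
    have "c1 * m1 * (m1 - 1) + c2 * m2 * (m2 - 1) =
       c1 * (m1 * (m1 - 1)) + c2 * (m2 * (m2 - 1))"
      by (simp add: mult_ac)
    also have "\<dots> = p * (z - 1) * (p * (c1 + c2) + (c1 * m1 + c2 * m2) - (c1 + c2))"
      unfolding char[of m1, simplified] char[of m2, simplified] by (simp add: algebra_simps)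
    finally show ?case using assms by (simp add: T0 B0)
  next
    case (Suc n)
    have "p * (z - 1) * B (Suc n) = p * (z - 1) * (p * T n + p * (z - 1) * B n)"
      by (simp add: B_Suc algebra_simps)
    also have "\<dots> = c1 * m1 ^ (n + 1) * (p * (z - 1) * (p + (m1 - 1)))
        + c2 * m2 ^ (n + 1) * (p * (z - 1) * (p + (m2 - 1)))"
      unfolding conjunct1[OF Suc] conjunct2[OF Suc] by (simp add: algebra_simps)
    also have "\<dots> = c1 * m1 ^ (Suc n + 1) * (m1 - 1) + c2 * m2 ^ (Suc n + 1) * (m2 - 1)"
      unfolding char[of m1, OF disjI1[OF refl], symmetric] char[of m2, OF disjI2[OF refl], symmetric]
      by (simp add: mult_ac)
    finally show ?case using Suc by (simp add: T_Suc algebra_simps)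
  qed
  then show ?thesis by (simp add: sum_prob_S_power T_def)
qed

section \<open>Coefficients of power series as circle integrals\<close>

lemma integral_cis_int:
  "((\<lambda>t. cis (of_int k * t)) has_integral (if k = 0 then 2 * pi else 0)) {-pi..pi}"
proof (cases "k = 0")
  case True
  then show ?thesis using has_integral_const_real[of "1::complex" "-pi" pi] by (simp add: scaleR_conv_of_real)
next
  case False
  have "((\<lambda>t. cis (of_int k * t)) has_integral
      (cis (of_int k * pi) / (\<i> * of_int k) - cis (of_int k * (-pi)) / (\<i> * of_int k))) {-pi..pi}"
  proof (rule fundamental_theorem_of_calculus)
    fix t assume "t \<in> {-pi..pi}"
    have "((\<lambda>t. exp (\<i> * of_int k * t) / (\<i> * of_int k)) has_vector_derivative exp (\<i> * of_int k * t))
       (at t within {-pi..pi})"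
      by (rule has_vector_derivative_real_field)
         (use False in \<open>auto intro!: derivative_eq_intros simp: field_simps\<close>)
    then show "((\<lambda>t. cis (of_int k * t) / (\<i> * of_int k)) has_vector_derivative cis (of_int k * t))
       (at t within {-pi..pi})"
      by (simp add: cis_conv_exp mult_ac)
  qed auto
  moreover have "cis (of_int k * pi) = cis (of_int k * (-pi))"
    using sin_zero_iff_int2[of "of_int k * pi"] by (simp add: complex_eq_iff)
  ultimately show ?thesis using False by simp
qed

text \<open>Cauchy's coefficient estimate, obtained without holomorphy: after multiplication by
  \<open>cis (- x * t)\<close> the partial sums converge uniformly on the circle, and termwise
  integration leaves only the coefficient with index \<open>x\<close>. An integrable majorant
  \<open>h\<close> in place of a supremum lets decay in \<open>t\<close> be exploited.\<close>

lemma power_series_coeff_bound: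
  fixes a :: "nat \<Rightarrow> complex" and H :: "complex \<Rightarrow> complex"
  assumes rho: "0 < \<rho>" "summable (\<lambda>j. norm (a j) * \<rho> ^ j)"
    and H: "\<And>z. norm z = \<rho> \<Longrightarrow> (\<lambda>j. a j * z ^ j) sums H z"
    and h: "\<And>t. t \<in> {-pi..pi} \<Longrightarrow> norm (H (\<rho> * cis t)) \<le> h t"
    and I: "(h has_integral I) {-pi..pi}"
  shows "norm (a x) * \<rho> ^ x \<le> I / (2 * pi)"
proof -
  define f where "f = (\<lambda>N t. \<Sum>j<N. a j * of_real \<rho> ^ j * cis (of_int (int j - int x) * t))"
  define g where "g = (\<lambda>t. H (\<rho> * cis t) * cis (- real x * t))"
  have term_eq: "a j * of_real \<rho> ^ j * cis (of_int (int j - int x) * t) =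
       a j * (\<rho> * cis t) ^ j * cis (- real x * t)" for j t
  proof -
    have "cis (of_int (int j - int x) * t) = cis t ^ j * cis (- real x * t)"
      by (subst Complex.DeMoivre, subst cis_mult) (simp add: algebra_simps)
    then show ?thesis by (simp add: power_mult_distrib)
  qed
  have lim: "uniform_limit {-pi..pi} f g sequentially"
  proof -
    have "uniform_limit {-pi..pi} f
       (\<lambda>t. \<Sum>j. a j * of_real \<rho> ^ j * cis (of_int (int j - int x) * t)) sequentially"
      unfolding f_def using rho
      by (intro Weierstrass_m_test[where M = "\<lambda>j. norm (a j) * \<rho> ^ j"])
         (auto simp: norm_mult norm_power)
    moreover have "(\<Sum>j. a j * of_real \<rho> ^ j * cis (of_int (int j - int x) * t)) = g t" for t
      unfolding term_eq g_def
      by (rule sums_unique[symmetric], rule sums_mult2, rule H) (use rho in \<open>simp add: norm_mult\<close>)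
    ultimately show ?thesis by simp
  qed
  have int_f: "(f N has_integral a x * \<rho> ^ x * (2 * pi)) {-pi..pi}" if "N > x" for N
  proof -
    have "(f N has_integral (\<Sum>j<N. a j * of_real \<rho> ^ j * (if int j - int x = 0 then 2 * pi else 0))) {-pi..pi}"
      unfolding f_def
      by (intro has_integral_sum has_integral_mult_right integral_cis_int) auto
    also have "(\<Sum>j<N. a j * of_real \<rho> ^ j * (if int j - int x = 0 then 2 * pi else 0)) =
       (\<Sum>j<N. if j = x then a x * of_real \<rho> ^ x * (2 * pi) else 0)"
      by (intro sum.cong) auto
    also have "\<dots> = a x * \<rho> ^ x * (2 * pi)" using that by simp
    finally show ?thesis .
  qed
  obtain If J where J: "\<And>N. (f N has_integral If N) {-pi..pi}" "(g has_integral J) {-pi..pi}" "If \<longlonglongrightarrow> J"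
  proof (rule uniform_limit_integral[OF lim])
    show "continuous_on {-pi..pi} (f N)" for N
      unfolding f_def by (intro continuous_intros)
  qed auto
  have "eventually (\<lambda>N. If N = a x * \<rho> ^ x * (2 * pi)) sequentially"
    using eventually_gt_at_top[of x] by eventually_elim (use J(1) int_f has_integral_unique in blast)
  then have "If \<longlonglongrightarrow> a x * \<rho> ^ x * (2 * pi)" by (rule tendsto_eventually)
  with J(3) have J_eq: "J = a x * \<rho> ^ x * (2 * pi)" by (rule LIMSEQ_unique)
  have "norm J \<le> I"
  proof -
    have "norm (integral {-pi..pi} g) \<le> integral {-pi..pi} h"
      by (rule integral_norm_bound_integral) (use J(2) I h in \<open>auto simp: g_def norm_mult\<close>)
    then show ?thesis using J(2) I by (simp add: integral_unique)
  qed
  then show ?thesis using rho by (simp add: J_eq norm_mult norm_power field_simps)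
qed

text \<open>This rational function replaces a Gaussian as majorant on the circle: its antiderivative
  is an arctangent, and it still yields the decisive factor \<open>1 / sqrt a\<close>.\<close>

lemma integral_inverse_quadratic:
  fixes a :: real
  assumes "0 < a"
  obtains I where "((\<lambda>t. 1 / (1 + a * t\<^sup>2)) has_integral I) {-pi..pi}" "I \<le> pi / sqrt a"
proof
  let ?F = "\<lambda>t. arctan (sqrt a * t) / sqrt a"
  show "((\<lambda>t. 1 / (1 + a * t\<^sup>2)) has_integral (?F pi - ?F (-pi))) {-pi..pi}"
  proof (rule fundamental_theorem_of_calculus)
    fix t
    show "(?F has_vector_derivative 1 / (1 + a * t\<^sup>2)) (at t within {-pi..pi})"
      unfolding has_real_derivative_iff_has_vector_derivative[symmetric] using assms
      by (auto intro!: derivative_eq_intros simp: power_mult_distrib divide_simps)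
  qed auto
  have "?F pi \<le> (pi / 2) / sqrt a" "- ?F (-pi) \<le> (pi / 2) / sqrt a"
    using assms arctan_ubound[of "sqrt a * pi"]
    by (auto simp: arctan_minus divide_simps)
  then show "?F pi - ?F (-pi) \<le> pi / sqrt a" by simp
qed

section \<open>Comparison of the generating functions\<close>

text \<open>From the cubic term on, the logarithmic series is dominated by
  \<open>norm z ^ 3 / 3\<close> times a geometric series with sum at most 2.\<close>

lemma Ln_approx_quadratic:
  fixes z :: complex
  assumes z: "norm z \<le> 1 / 2"
  shows "norm (Ln (1 + z) - z + z\<^sup>2 / 2) \<le> norm z ^ 3"
proof -
  have z1: "norm z < 1" using z by simp
  have "(\<lambda>n. - ((-z) ^ n) / of_nat n) sums Ln (1 + z)" by (rule Ln_series'[OF z1])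
  from sums_split_initial_segment[OF this, of 3]
  have S: "(\<lambda>n. - ((-z) ^ (n + 3)) / of_nat (n + 3)) sums (Ln (1 + z) - z + z\<^sup>2 / 2)"
    by (simp add: eval_nat_numeral diff_diff_eq2 diff_add_eq)
  have G: "(\<lambda>n. norm z ^ 3 / 3 * norm z ^ n) sums (norm z ^ 3 / 3 * (1 / (1 - norm z)))"
    by (intro sums_mult geometric_sums) (use z1 in simp)
  have le: "norm (- ((-z) ^ (n + 3)) / of_nat (n + 3)) \<le> norm z ^ 3 / 3 * norm z ^ n" for n
  proof -
    have "norm (- ((-z) ^ (n + 3)) / of_nat (n + 3) :: complex) = norm z ^ (n + 3) / real (n + 3)"
      by (simp only: norm_divide norm_minus_cancel norm_power norm_of_nat)
    also have "\<dots> \<le> norm z ^ (n + 3) / 3" by (intro divide_left_mono) auto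
    finally show ?thesis by (simp add: power_add mult_ac)
  qed
  have "norm (Ln (1 + z) - z + z\<^sup>2 / 2) \<le> norm z ^ 3 / 3 * (1 / (1 - norm z))"
    by (rule norm_sums_le[OF S G le])
  also have "\<dots> \<le> norm z ^ 3 / 3 * 2"
    by (intro mult_left_mono) (use z in \<open>auto simp: divide_simps\<close>)
  also have "\<dots> \<le> norm z ^ 3" by simp
  finally show ?thesis .
qed

lemma norm_mult_exp_minus_1_le:
  fixes e W :: complex
  assumes "norm e + norm W \<le> \<kappa>"
  shows "norm ((1 + e) * exp W - 1) \<le> \<kappa> * exp \<kappa>"
proof -
  have eq: "(1 + e) * exp W - 1 = (exp W - 1) + e * exp W" by (simp add: algebra_simps)
  have "norm (exp W - 1) \<le> norm W * exp (norm W)"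
    using Taylor_exp_field[of W 0] by (simp add: mult.commute)
  moreover have "norm (e * exp W) \<le> norm e * exp (norm W)"
    by (simp add: norm_mult mult_left_mono complex_Re_le_cmod)
  ultimately have "norm ((1 + e) * exp W - 1) \<le> (norm e + norm W) * exp (norm W)"
    unfolding eq using norm_triangle_ineq[of "exp W - 1" "e * exp W"] by (simp add: algebra_simps)
  also have "\<dots> \<le> \<kappa> * exp \<kappa>"
    by (intro mult_mono) (use assms in \<open>auto intro: order_trans[OF _ assms]\<close>)
  finally show ?thesis .
qed

text \<open>\<open>1 + w\<close> is the dominant characteristic root, and \<open>s\<close>, the
  difference of the two roots, is a square root of the discriminant. The principal branch has
  nonnegative real part, which keeps \<open>1 + w - p * u\<close> away from 0; the bound on
  \<open>w\<close> then follows from \<open>w * (1 + w - p * u) = p^2 * u\<close>.\<close>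

lemma transfer_root:
  fixes p :: real and u :: complex
  assumes p: "0 < p" "p \<le> 1 / 100" and u: "norm u \<le> 3"
  obtains w s where "s = 1 - p * u + 2 * w" "w + w\<^sup>2 = p\<^sup>2 * u + p * u * w"
    "norm w \<le> 4 * p\<^sup>2 * norm u" "1 / 2 \<le> norm s"
proof -
  define s where "s = csqrt ((1 + p * u)\<^sup>2 - 4 * p * (1 - p) * u)"
  define w where "w = (s - 1 + p * u) / 2"
  have s_w: "s = 1 - p * u + 2 * w" by (simp add: w_def field_simps)
  have "s\<^sup>2 = (1 + p * u)\<^sup>2 - 4 * p * (1 - p) * u" by (simp add: s_def)
  then have "4 * (w + w\<^sup>2) = 4 * (p\<^sup>2 * u + p * u * w)"
    unfolding s_w by (simp add: power2_eq_square algebra_simps)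
  then have w_eq: "w + w\<^sup>2 = p\<^sup>2 * u + p * u * w"
    unfolding mult_cancel_left by simp
  have pu: "norm (p * u) \<le> 3 / 100"
    using mult_mono[of p "1/100" "norm u" 3] p u by (simp add: norm_mult)
  have "0 \<le> Re s" using csqrt_principal[of "(1 + p * u)\<^sup>2 - 4 * p * (1 - p) * u"] unfolding s_def by linarith
  moreover have "Re (p * u) \<le> 3 / 100" using complex_Re_le_cmod[of "p * u"] pu by linarith
  ultimately have "1 / 4 \<le> Re (1 + w - p * u)" by (simp add: w_def field_simps)
  then have "1 / 4 \<le> norm (1 + w - p * u)" using complex_Re_le_cmod order_trans by blast
  then have "norm w * (1 / 4) \<le> norm w * norm (1 + w - p * u)" by (intro mult_left_mono) auto
  also have "\<dots> = norm (p\<^sup>2 * u)"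
    unfolding norm_mult[symmetric] using w_eq
    by (intro arg_cong[where f = norm]) (simp add: algebra_simps power2_eq_square)
  finally have w: "norm w \<le> 4 * p\<^sup>2 * norm u" by (simp add: norm_mult norm_power)
  have "p\<^sup>2 \<le> (1 / 100)\<^sup>2" using p by (intro power_mono) auto
  then have "4 * p\<^sup>2 * norm u \<le> 4 * (1 / 100)\<^sup>2 * 3" using u by (intro mult_mono) auto
  then have w': "norm w \<le> 12 / 10000" using w by (simp add: power2_eq_square)
  have "norm (1 :: complex) \<le> norm s + norm (p * u) + norm (2 * w)"
    unfolding s_w using norm_triangle_ineq[of "1 - p * u + 2 * w" "p * u - 2 * w"]
      norm_triangle_ineq4[of "p * u" "2 * w"] by simp
  then have "1 / 2 \<le> norm s" using pu w' by (simp add: norm_mult)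
  then show ?thesis using that s_w w_eq w by blast
qed

text \<open>Insert the first approximation \<open>p^2 * u\<close> for \<open>w\<close> into
  \<open>w = p^2 * u + p * u * w - w^2\<close>. The product gives \<open>p^3 * u^2\<close>, and the
  two quadratic terms \<open>- w^2\<close> and \<open>- w^2 / 2\<close> together give
  \<open>- 3/2 * p^4 * u^2\<close>. The latter is kept because the remainder has to be cubic in
  \<open>u\<close>.\<close>

lemma transfer_root_expansion:
  fixes p :: real and u w :: complex
  assumes p: "0 < p" "p \<le> 1 / 100" and u: "norm u \<le> 3"
    and w: "w + w\<^sup>2 = p\<^sup>2 * u + p * u * w" "norm w \<le> 4 * p\<^sup>2 * norm u"
  shows "norm (w - w\<^sup>2 / 2 - (p\<^sup>2 * u + (p ^ 3 - 3 / 2 * p ^ 4) * u\<^sup>2)) \<le> 7 * p ^ 4 * norm u ^ 3"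
proof -
  let ?v = "norm u"
  have pk: "p * x \<le> x / 100" if "0 \<le> x" for x :: real
    using mult_right_mono[OF p(2) that] by simp
  have nn: "0 \<le> p ^ i * ?v ^ j" for i j using p by simp
  have d1: "norm (w - p\<^sup>2 * u) \<le> 5 * p ^ 3 * ?v\<^sup>2"
  proof -
    have "w - p\<^sup>2 * u = p * u * w - w\<^sup>2" using w(1) by (simp add: algebra_simps)
    then have "norm (w - p\<^sup>2 * u) \<le> norm (p * u * w) + norm (w\<^sup>2)" by (simp add: norm_triangle_ineq4)
    also have "norm (p * u * w) \<le> p * ?v * (4 * p\<^sup>2 * ?v)"
      using w p by (auto simp: norm_mult intro!: mult_left_mono)
    also have "norm (w\<^sup>2) \<le> (4 * p\<^sup>2 * ?v)\<^sup>2"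
      unfolding norm_power using w by (intro power_mono) auto
    also have "(4 * p\<^sup>2 * ?v)\<^sup>2 = 16 * (p * (p ^ 3 * ?v\<^sup>2))" by (simp add: eval_nat_numeral)
    also have "\<dots> \<le> p ^ 3 * ?v\<^sup>2" using pk[of "p ^ 3 * ?v\<^sup>2"] nn[of 3 2] by linarith
    finally show ?thesis by (simp add: eval_nat_numeral algebra_simps)
  qed
  have d2: "norm (w\<^sup>2 - p ^ 4 * u\<^sup>2) \<le> p ^ 4 * ?v ^ 3"
  proof -
    have "w\<^sup>2 - p ^ 4 * u\<^sup>2 = (w - p\<^sup>2 * u) * (w + p\<^sup>2 * u)"
      by (simp add: algebra_simps eval_nat_numeral)
    then have "norm (w\<^sup>2 - p ^ 4 * u\<^sup>2) = norm (w - p\<^sup>2 * u) * norm (w + p\<^sup>2 * u)"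
      by (simp add: norm_mult)
    also have "norm (w + p\<^sup>2 * u) \<le> 5 * p\<^sup>2 * ?v"
      using norm_triangle_ineq[of w "p\<^sup>2 * u"] w(2) by (simp add: norm_mult norm_power)
    also have "norm (w - p\<^sup>2 * u) * (5 * p\<^sup>2 * ?v) \<le> (5 * p ^ 3 * ?v\<^sup>2) * (5 * p\<^sup>2 * ?v)"
      by (intro mult_right_mono d1) (use p in auto)
    also have "\<dots> = 25 * (p * (p ^ 4 * ?v ^ 3))" by (simp add: eval_nat_numeral)
    also have "\<dots> \<le> p ^ 4 * ?v ^ 3" using pk[of "p ^ 4 * ?v ^ 3"] nn[of 4 3] by linarith
    finally show ?thesis by (simp add: mult_left_mono)
  qed
  have d3: "norm (p * u * (w - p\<^sup>2 * u)) \<le> 5 * p ^ 4 * ?v ^ 3"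
  proof -
    have "norm (p * u * (w - p\<^sup>2 * u)) \<le> (p * ?v) * (5 * p ^ 3 * ?v\<^sup>2)"
      using mult_left_mono[OF d1, of "p * ?v"] p by (simp add: norm_mult)
    then show ?thesis by (simp add: eval_nat_numeral mult_ac)
  qed
  have eq: "w - w\<^sup>2 / 2 - (p\<^sup>2 * u + (p ^ 3 - 3 / 2 * p ^ 4) * u\<^sup>2) =
     p * u * (w - p\<^sup>2 * u) - (3 / 2) * (w\<^sup>2 - p ^ 4 * u\<^sup>2)"
    using w(1) by (simp add: eval_nat_numeral field_simps) algebra
  have "norm (p * u * (w - p\<^sup>2 * u) - (3 / 2) * (w\<^sup>2 - p ^ 4 * u\<^sup>2)) \<le>
     norm (p * u * (w - p\<^sup>2 * u)) + norm ((3 / 2) * (w\<^sup>2 - p ^ 4 * u\<^sup>2))"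
    by (rule norm_triangle_ineq4)
  also have "norm ((3 / 2) * (w\<^sup>2 - p ^ 4 * u\<^sup>2)) = 3 / 2 * norm (w\<^sup>2 - p ^ 4 * u\<^sup>2)"
    by (subst norm_mult) simp
  finally have "norm (p * u * (w - p\<^sup>2 * u) - (3 / 2) * (w\<^sup>2 - p ^ 4 * u\<^sup>2)) \<le>
     5 * p ^ 4 * ?v ^ 3 + 3 / 2 * (p ^ 4 * ?v ^ 3)"
    using d2 d3 by linarith
  also have "\<dots> \<le> 7 * p ^ 4 * ?v ^ 3" using p by (simp add: mult_right_mono)
  finally show ?thesis unfolding eq .
qed

text \<open>With \<open>m1 = 1 + w\<close> and \<open>m2 = p * u - w\<close>, the weight of the
  small root is \<open>w / s\<close>. Replacing \<open>c1 * m1\<close> by \<open>1 - c2 * m2\<close>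
  isolates the factor \<open>(1 + w) ^ n\<close> and leaves a correction close to 1.\<close>

lemma gf_S_xi_eq:
  fixes p :: real and u w s :: complex
  assumes p: "0 \<le> p" "p \<le> 1" and "s = 1 - p * u + 2 * w" "w + w\<^sup>2 = p\<^sup>2 * u + p * u * w"
    and "s \<noteq> 0" "1 + w \<noteq> 0"
  shows "(\<Sum>j\<le>n. of_real (prob_S n p j) * (1 + u) ^ j) =
    (1 + w) ^ n * (1 - w * (p * u - w) / s * (1 - ((p * u - w) / (1 + w)) ^ n))"
proof -
  define m1 where "m1 = 1 + w"
  define m2 where "m2 = p * u - w"
  define c1 where "c1 = (1 - m2) / s"
  define c2 where "c2 = w / s"
  have s: "m1 - m2 = s" using assms(3) by (simp add: m1_def m2_def)
  have prod: "m1 * m2 = of_real (p * (1 - p)) * (1 + u - 1)"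
  proof -
    have "m1 * m2 = p * u + p * u * w - (w + w\<^sup>2)"
      by (simp add: m1_def m2_def algebra_simps power2_eq_square)
    also have "\<dots> = of_real (p * (1 - p)) * (1 + u - 1)"
      unfolding assms(4) by (simp add: algebra_simps power2_eq_square)
    finally show ?thesis .
  qed
  have c: "c1 + c2 = 1" "c1 * m1 + c2 * m2 = 1"
  proof -
    have "c1 + c2 = (m1 - m2) / s" by (simp add: c1_def c2_def m1_def add_divide_distrib diff_divide_distrib)
    then show "c1 + c2 = 1" using s assms(5) by simp
    have "c1 * m1 + c2 * m2 = ((1 - m2) * m1 + w * m2) / s"
      by (simp add: c1_def c2_def add_divide_distrib)
    also have "(1 - m2) * m1 + w * m2 = m1 - m2" by (simp add: m1_def algebra_simps)
    finally show "c1 * m1 + c2 * m2 = 1" using s assms(5) by simp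
  qed
  have "(\<Sum>j\<le>n. of_real (prob_S n p j) * (1 + u) ^ j) = c1 * m1 ^ (n + 1) + c2 * m2 ^ (n + 1)"
    by (rule gf_S_xi[OF p _ prod c]) (simp add: m1_def m2_def)
  also have "\<dots> = c1 * m1 * m1 ^ n + c2 * m2 * m2 ^ n" by simp
  also have "c1 * m1 = 1 - c2 * m2" using c(2) by (simp add: algebra_simps)
  also have "(1 - c2 * m2) * m1 ^ n + c2 * m2 * m2 ^ n =
     m1 ^ n * (1 - c2 * m2 * (1 - (m2 / m1) ^ n))"
  proof -
    have "m1 ^ n * (m2 / m1) ^ n = m2 ^ n" using assms(6) by (simp add: m1_def power_divide)
    then show ?thesis by (simp add: algebra_simps)
  qed
  finally show ?thesis by (simp add: m1_def m2_def c2_def)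
qed

text \<open>The negative binomial law has mean \<open>r * b\<close> and variance
  \<open>r * b * (1 + b)\<close>; the hypotheses equate these with the mean and variance of the
  2-runs statistic. Hence in \<open>n * Ln (1 + w) + r * Ln (1 - b * u)\<close> the linear terms
  cancel, and the quadratic ones cancel up to the boundary term \<open>p^3 * (1 - p) * u^2\<close>,
  which is simply bounded.\<close>

lemma gf_S_xi_approx:
  fixes p r b :: real and u :: complex
  assumes p: "0 < p" "p \<le> 1 / 100" and u: "norm u \<le> 3" and n: "0 < n"
    and b: "0 < b" "b \<le> 2 * p" "b = p * (2 - 3 * p) - 2 * p * (1 - p) / n" and r: "r * b = n * p\<^sup>2"
    and \<kappa>: "\<kappa> = 12 * n * p ^ 4 * norm u ^ 3 + 300 * p ^ 3"
  defines "G \<equiv> exp (- (r * Ln (1 - b * u)))"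
  shows "norm ((\<Sum>j\<le>n. of_real (prob_S n p j) * (1 + u) ^ j) - G) \<le> norm G * (\<kappa> * exp \<kappa>)"
proof -
  let ?v = "norm u"
  obtain w s where s: "s = 1 - p * u + 2 * w" and w: "w + w\<^sup>2 = p\<^sup>2 * u + p * u * w"
    "norm w \<le> 4 * p\<^sup>2 * ?v" and s_ge: "1 / 2 \<le> norm s"
    using transfer_root[OF p u] .
  have pk: "p * x \<le> x / 100" if "0 \<le> x" for x :: real
    using mult_right_mono[OF p(2) that] by simp
  have nn: "0 \<le> p ^ i * ?v ^ j" for i j using p by simp
  have "4 * p\<^sup>2 * ?v \<le> 4 * p\<^sup>2 * 3" using u by (intro mult_left_mono) auto
  then have w12: "norm w \<le> 12 * p\<^sup>2" using w(2) by linarith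
  also have "12 * p\<^sup>2 \<le> p" using pk[of p] p by (simp add: power2_eq_square)
  finally have wp: "norm w \<le> p" .
  have w1: "1 / 2 \<le> norm (1 + w)"
    using norm_triangle_ineq4[of "1 + w" w] wp p by simp
  have "p * norm u \<le> p * 3" using u p by (intro mult_left_mono) auto
  then have "norm (p * u) \<le> 3 * p" using p by (simp add: norm_mult)
  then have m2: "norm (p * u - w) \<le> 4 * p"
    using norm_triangle_ineq4[of "p * u" w] wp by linarith
  define e where "e = - (w * (p * u - w) / s * (1 - ((p * u - w) / (1 + w)) ^ n))"
  have e: "norm e \<le> 200 * p ^ 3"
  proof -
    \<comment> \<open>The roots have ratio at most 1 in modulus, since \<open>4 * p\<close> is below
      \<open>1 / 2\<close>; this makes the bound on \<open>e\<close> uniform in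
      \<open>n\<close>.\<close>
    have "norm ((p * u - w) / (1 + w)) \<le> (1 / 2) / (1 / 2)"
      unfolding norm_divide using m2 w1 p by (intro frac_le) auto
    then have "norm (((p * u - w) / (1 + w)) ^ n) \<le> 1"
      unfolding norm_power by (intro power_le_one) auto
    then have 1: "norm (1 - ((p * u - w) / (1 + w)) ^ n) \<le> 2"
      using norm_triangle_ineq4[of 1 "((p * u - w) / (1 + w)) ^ n"] by simp
    have "norm (w * (p * u - w) / s) \<le> (12 * p\<^sup>2 * (4 * p)) / (1 / 2)"
      unfolding norm_divide norm_mult using w12 m2 s_ge p by (intro frac_le mult_mono) auto
    then have "norm e \<le> (12 * p\<^sup>2 * (4 * p)) / (1 / 2) * 2"
      unfolding e_def norm_minus_cancel norm_mult[of "w * (p * u - w) / s"] using 1 p by (intro mult_mono) auto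
    also have "\<dots> = 192 * p ^ 3" by (simp add: eval_nat_numeral)
    also have "\<dots> \<le> 200 * p ^ 3" using p by simp
    finally show ?thesis .
  qed
  define E1 where "E1 = Ln (1 + w) - w + w\<^sup>2 / 2"
  define E2 where "E2 = Ln (1 + (- b * u)) - (- b * u) + (- b * u)\<^sup>2 / 2"
  have E1: "norm E1 \<le> p ^ 4 * ?v ^ 3"
  proof -
    have "norm E1 \<le> norm w ^ 3" unfolding E1_def using wp p by (intro Ln_approx_quadratic) auto
    also have "\<dots> \<le> (4 * p\<^sup>2 * ?v) ^ 3" using w by (intro power_mono) auto
    also have "\<dots> = 64 * (p * (p * (p ^ 4 * ?v ^ 3)))" by (simp add: eval_nat_numeral)
    also have "\<dots> \<le> p ^ 4 * ?v ^ 3"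
      using pk[OF nn[of 4 3]] pk[OF mult_nonneg_nonneg[OF less_imp_le[OF p(1)] nn[of 4 3]]] nn[of 4 3]
      by linarith
    finally show ?thesis .
  qed
  have E2: "norm (r * E2) \<le> 4 * n * p ^ 4 * ?v ^ 3"
  proof -
    have "b * ?v \<le> (2 * p) * 3" using b u by (intro mult_mono) auto
    moreover have bu: "norm (- b * u) = b * ?v" using b(1) by (simp add: norm_mult)
    ultimately have "norm (- b * u) \<le> 1 / 2" using p by linarith
    then have "norm E2 \<le> norm (- b * u) ^ 3" unfolding E2_def by (rule Ln_approx_quadratic)
    then have 1: "norm E2 \<le> b ^ 3 * ?v ^ 3" unfolding bu by (simp add: power_mult_distrib)
    have "0 < r * b" using n p by (simp add: r)
    then have "0 < r" using b by (simp add: zero_less_mult_iff)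
    then have "norm (r * E2) \<le> r * (b ^ 3 * ?v ^ 3)" using 1 by (simp add: norm_mult)
    also have "\<dots> = (r * b) * b\<^sup>2 * ?v ^ 3" by (simp add: eval_nat_numeral)
    also have "\<dots> \<le> (n * p\<^sup>2) * (2 * p)\<^sup>2 * ?v ^ 3"
      unfolding r using b by (intro mult_mono power_mono) auto
    finally show ?thesis by (simp add: eval_nat_numeral mult_ac)
  qed
  define A where "A = w - w\<^sup>2 / 2 - (p\<^sup>2 * u + (p ^ 3 - 3 / 2 * p ^ 4) * u\<^sup>2)"
  have A: "norm A \<le> 7 * p ^ 4 * ?v ^ 3"
    unfolding A_def by (rule transfer_root_expansion[OF p u w])
  define W where "W = n * Ln (1 + w) + r * Ln (1 - b * u)"
  \<comment> \<open>This is the matching of variances: \<open>r * b * b\<close> is the excess of the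
    variance over the mean.\<close>
  have rb2: "r * b * b = 2 * (n * (p ^ 3 - 3 / 2 * p ^ 4) - p ^ 3 * (1 - p))"
    unfolding r unfolding b(3) using n by (simp add: field_simps eval_nat_numeral)
  have W_eq: "W = n * A + p ^ 3 * (1 - p) * u\<^sup>2 + n * E1 + r * E2"
  proof -
    have "W = n * (w - w\<^sup>2 / 2) + n * E1 - of_real (r * b) * u - of_real (r * b * b) * u\<^sup>2 / 2 + r * E2"
      by (simp add: W_def E1_def E2_def algebra_simps power2_eq_square)
    also have "of_real (r * b * b) * u\<^sup>2 / 2 =
        of_real n * of_real (p ^ 3 - 3 / 2 * p ^ 4) * u\<^sup>2 - p ^ 3 * (1 - p) * u\<^sup>2"
      unfolding rb2 by (simp only: of_real_mult of_real_diff) (simp add: left_diff_distrib)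
    also have "of_real (r * b) * u = of_real n * of_real (p\<^sup>2) * u" unfolding r by simp
    finally show ?thesis unfolding A_def by (simp only: right_diff_distrib distrib_left mult.assoc) simp
  qed
  have "norm W \<le> norm (n * A) + norm (p ^ 3 * (1 - p) * u\<^sup>2) + norm (n * E1) + norm (r * E2)"
    unfolding W_eq by (intro norm_triangle_le add_mono order_refl)
  moreover have "norm (n * A) \<le> n * (7 * p ^ 4 * ?v ^ 3)" using A by (simp add: norm_mult mult_left_mono)
  moreover have "norm (n * E1) \<le> n * (p ^ 4 * ?v ^ 3)" using E1 by (simp add: norm_mult mult_left_mono)
  moreover have "norm (p ^ 3 * (1 - p) * u\<^sup>2) \<le> 9 * p ^ 3"
  proof -
    have "norm (p ^ 3 * (1 - p) * u\<^sup>2) = p ^ 3 * ((1 - p) * ?v\<^sup>2)"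
      unfolding norm_mult[of _ "u\<^sup>2"] norm_power norm_of_real using p by simp
    also have "\<dots> \<le> p ^ 3 * (1 * 3\<^sup>2)" using p u by (intro mult_left_mono mult_mono power_mono) auto
    finally show ?thesis by simp
  qed
  moreover have "0 \<le> p ^ 3" using p by simp
  \<comment> \<open>The constant 12 is 7 + 1 + 4, from \<open>A\<close>, \<open>E1\<close> and
    \<open>r * E2\<close>; the terms in \<open>p ^ 3\<close> add up to at most 200 + 9, which is
    below 300.\<close>
  ultimately have "norm e + norm W \<le> \<kappa>" using e E2 unfolding \<kappa> by linarith
  then have bound: "norm ((1 + e) * exp W - 1) \<le> \<kappa> * exp \<kappa>" by (rule norm_mult_exp_minus_1_le)
  have ne: "1 + w \<noteq> 0" "s \<noteq> 0" using w1 s_ge by auto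
  have "(\<Sum>j\<le>n. of_real (prob_S n p j) * (1 + u) ^ j) = (1 + w) ^ n * (1 + e)"
    using gf_S_xi_eq[OF _ _ s w(1) ne(2,1), of n] p by (simp add: e_def)
  also have "(1 + w) ^ n = exp (n * Ln (1 + w))" using ne by (simp add: exp_of_nat_mult)
  also have "\<dots> = G * exp W" by (simp add: G_def W_def flip: exp_add)
  finally have "(\<Sum>j\<le>n. of_real (prob_S n p j) * (1 + u) ^ j) - G = G * ((1 + e) * exp W - 1)"
    by (simp add: algebra_simps)
  then show ?thesis using bound by (simp add: norm_mult mult_left_mono)
qed

section \<open>The negative binomial distribution\<close>

text \<open>The fourth-order Taylor bound suffices on the whole interval because \<open>pi\<close>
  squared is at most 10, and \<open>1/2 - 10/24 = 1/12\<close>.\<close>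

lemma one_minus_cos_ge:
  fixes t :: real
  assumes "\<bar>t\<bar> \<le> pi"
  shows "t\<^sup>2 / 12 \<le> 1 - cos t"
proof -
  obtain s where s: "cos t = (\<Sum>m<4. cos_coeff m * t ^ m) + cos (s + 1 / 2 * real 4 * pi) / fact 4 * t ^ 4"
    using Maclaurin_cos_expansion[of t 4] by blast
  have "cos (s + 1 / 2 * real 4 * pi) / fact 4 * t ^ 4 \<le> 1 / fact 4 * t ^ 4"
    by (intro mult_right_mono divide_right_mono) auto
  then have "cos t \<le> 1 - t\<^sup>2 / 2 + t ^ 4 / 24"
    using s by (simp add: cos_coeff_def lessThan_nat_numeral fact_numeral)
  moreover have "t ^ 4 \<le> 10 * t\<^sup>2"
  proof -
    have "t\<^sup>2 \<le> pi\<^sup>2" using power_mono[OF assms, of 2] by simp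
    also have "\<dots> \<le> (315 / 100)\<^sup>2" using pi_approx by (intro power_mono) auto
    also have "\<dots> \<le> 10" by (simp add: power2_eq_square)
    finally have "t\<^sup>2 * t\<^sup>2 \<le> 10 * t\<^sup>2" by (intro mult_right_mono) auto
    then show ?thesis by (simp add: eval_nat_numeral mult_ac)
  qed
  ultimately show ?thesis by (simp add: field_simps)
qed

text \<open>Stirling's bound with \<open>exp 1\<close> as constant, which is exact at
  \<open>x = 1\<close>. The induction step amounts to
  \<open>(x + 1/2) * ln (1 + 1/x) \<ge> 1\<close>, the midpoint estimate for the integral of the
  convex function \<open>1/t\<close>.\<close>

lemma fact_le_stirling:
  assumes "0 < x"
  shows "fact x \<le> exp (1 - real x) * sqrt x * real x ^ x"
  using assms
proof (induction x rule: nat_induct_non_zero)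
  case 1
  show ?case by simp
next
  case (Suc x)
  let ?x = "real x"
  have x: "0 < ?x" using Suc by simp
  have "1 \<le> (?x + 1 / 2) * (ln (?x + 1) - ln ?x)"
    using mult_left_mono[OF ln_inverse_approx_ge[of ?x "?x + 1"], of "?x + 1 / 2"] x
    by (simp add: field_simps)
  then have "1 + ln (sqrt ?x) + ?x * ln ?x \<le> ln (sqrt (?x + 1)) + ?x * ln (?x + 1)"
    using x by (simp add: ln_sqrt algebra_simps)
  then have "exp (1 + ln (sqrt ?x) + ?x * ln ?x) \<le> exp (ln (sqrt (?x + 1)) + ?x * ln (?x + 1))"
    by simp
  then have "exp 1 * sqrt ?x * ?x ^ x \<le> sqrt (?x + 1) * (?x + 1) ^ x"
    using x by (simp add: exp_add exp_of_nat_mult)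
  then have *: "exp (- ?x) * (?x + 1) * (exp 1 * sqrt ?x * ?x ^ x) \<le>
     exp (- ?x) * (?x + 1) * (sqrt (?x + 1) * (?x + 1) ^ x)"
    using x by (intro mult_left_mono) auto
  have "fact (Suc x) \<le> (?x + 1) * (exp (1 - ?x) * sqrt ?x * ?x ^ x)"
    using Suc.IH x by (simp add: mult_left_mono add.commute)
  also have "\<dots> \<le> exp (- ?x) * (?x + 1) * (sqrt (?x + 1) * (?x + 1) ^ x)"
    using * by (simp add: exp_diff exp_minus field_simps)
  finally show ?case by (simp add: mult_ac add.commute)
qed

text \<open>A Stirling-type lower bound for \<open>Gamma (r + x) / Gamma r\<close> with real
  \<open>r\<close>. With \<open>y = r + x\<close>, the induction step reduces to
  \<open>(1 + 1/y) powr y \<le> exp 1\<close>; the factor \<open>r / (r + x)\<close> is what makes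
  the product telescope.\<close>

lemma pochhammer_ge:
  fixes r :: real
  assumes "0 < r"
  shows "(r + x) powr (r + x) / r powr r * exp (- real x) * (r / (r + x)) \<le> pochhammer r x"
proof (induction x)
  case 0
  show ?case using assms by simp
next
  case (Suc x)
  define y where "y = r + x"
  have y: "0 < y" using assms by (simp add: y_def)
  have "y * ln (1 + 1 / y) \<le> 1"
    using mult_left_mono[OF ln_add_one_self_le_self[of "1 / y"], of y] y by simp
  moreover have "ln (1 + 1 / y) = ln (y + 1) - ln y"
  proof -
    have "1 + 1 / y = (y + 1) / y" using y by (simp add: field_simps)
    then show ?thesis using y by (simp add: ln_div)
  qed
  ultimately have "exp (y * ln (y + 1)) \<le> exp (1 + y * ln y)" by (simp add: algebra_simps)
  then have "(y + 1) powr y \<le> exp 1 * y powr y" using y by (simp add: powr_def exp_add)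
  then have "(y + 1) powr y * (exp (- real x - 1) / r powr r * r) \<le>
      exp 1 * y powr y * (exp (- real x - 1) / r powr r * r)"
    using assms by (intro mult_right_mono) auto
  moreover have "(r + Suc x) powr (r + Suc x) / r powr r * exp (- real (Suc x)) * (r / (r + Suc x)) =
     (y + 1) powr y * (exp (- real x - 1) / r powr r * r)"
    using y assms by (simp add: y_def add_ac powr_add)
  moreover have "exp 1 * y powr y * (exp (- real x - 1) / r powr r * r) =
     y * ((r + x) powr (r + x) / r powr r * exp (- real x) * (r / (r + x)))"
    using y by (simp add: y_def[symmetric] exp_diff)
  moreover have "\<dots> \<le> y * pochhammer r x" using Suc y by (intro mult_left_mono) auto
  ultimately show ?case by (simp add: pochhammer_Suc y_def mult.commute)
qed

lemma NB_eq:
  assumes "0 < r"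
  shows "NB r q x = pochhammer r x / fact x * q powr r * (1 - q) ^ x"
proof -
  have "r \<notin> \<int>\<^sub>\<le>\<^sub>0" using assms nonpos_Ints_nonpos[of r] by auto
  then show ?thesis by (simp add: NB_def pochhammer_Gamma)
qed

text \<open>The binomial series at \<open>- P * z\<close>, combined with
  \<open>1 - b * (z - 1) = (1 + b) * (1 - P * z)\<close>. The factor \<open>1 + b\<close> is a
  positive real, so splitting the logarithm causes no branch change. The hypothesis on
  \<open>norm z\<close> says \<open>norm (P * z) < 1\<close> and so admits radii above 1.\<close>

lemma NB_gf_sums:
  fixes r b :: real and z :: complex
  assumes "0 < r" "0 < b" "norm z * b < 1 + b"
  shows "(\<lambda>j. of_real (NB r (1 / (1 + b)) j) * z ^ j) sums exp (- (r * Ln (1 - b * (z - 1))))"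
proof -
  define P where "P = b / (1 + b)"
  have Q: "1 - 1 / (1 + b) = P" using assms by (simp add: P_def field_simps)
  have "0 < P" using assms by (simp add: P_def)
  then have "norm (- P * z) = P * norm z" by (simp add: norm_mult)
  also have "\<dots> < 1" using assms by (simp add: P_def divide_simps mult.commute)
  finally have Pz: "norm (- P * z) < 1" .
  then have nz: "1 - P * z \<noteq> 0" by auto
  have "(\<lambda>j. ((of_real (- r) :: complex) gchoose j) * (- P * z) ^ j) sums (1 + (- P * z)) powr of_real (- r)"
    by (rule gen_binomial_complex[OF Pz])
  then have "(\<lambda>j. of_real ((1 / (1 + b)) powr r) * (((of_real (- r) :: complex) gchoose j) * (- P * z) ^ j)) sums
     (of_real ((1 / (1 + b)) powr r) * (1 + (- P * z)) powr of_real (- r))"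
    by (rule sums_mult)
  moreover have "of_real ((1 / (1 + b)) powr r) * (((of_real (- r) :: complex) gchoose j) * (- P * z) ^ j) =
      of_real (NB r (1 / (1 + b)) j) * z ^ j" for j
  proof -
    have "(- P * z) ^ j = (- 1) ^ j * (of_real P ^ j * z ^ j)"
      using power_mult_distrib[of "- 1" "P * z" j] by (simp add: power_mult_distrib)
    moreover have "((of_real (- r) :: complex) gchoose j) = (- 1) ^ j * of_real (pochhammer r j) / fact j"
      by (simp add: gbinomial_pochhammer pochhammer_of_real)
    moreover have "(- 1) ^ j * (- 1 :: complex) ^ j = 1" by (cases "even j") auto
    ultimately show ?thesis
      by (simp add: NB_eq[OF assms(1)] Q)
  qed
  moreover have "of_real ((1 / (1 + b)) powr r) * (1 + (- P * z)) powr of_real (- r) =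
      exp (- (r * Ln (1 - b * (z - 1))))"
  proof -
    have "b = (1 + b) * P" using assms by (simp add: P_def)
    then have "complex_of_real b = of_real (1 + b) * of_real P" by (metis of_real_mult)
    moreover have "1 - b * (z - 1) = of_real (1 + b) - of_real b * z" by (simp add: algebra_simps)
    ultimately have "1 - b * (z - 1) = of_real (1 + b) * (1 - P * z)"
      by (simp only: right_diff_distrib mult.assoc mult_1_right)
    then have "Ln (1 - b * (z - 1)) = of_real (ln (1 + b)) + Ln (1 - P * z)"
      using Ln_times_of_real[of "1 + b" "1 - P * z"] Ln_of_real[of "1 + b"] assms nz by simp
    moreover have "of_real ((1 / (1 + b)) powr r) = exp (- (of_real r * of_real (ln (1 + b)) :: complex))"
    proof -
      have *: "(1 / (1 + b)) powr r = exp (- (r * ln (1 + b)))"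
        using assms by (simp add: powr_def ln_div)
      show ?thesis unfolding * exp_of_real[symmetric] by simp
    qed
    moreover have "(1 + (- P * z)) powr of_real (- r) = exp (- (r * Ln (1 - P * z)))"
      using nz by (simp add: powr_def)
    ultimately show ?thesis by (simp add: distrib_left flip: exp_add)
  qed
  ultimately show ?thesis by simp
qed

text \<open>The squared modulus of \<open>c\<close> is \<open>A^2 + 2 * (1 + b) * y\<close>, which
  is at least \<open>A^2 * (1 + y)\<close> because \<open>A^2 \<le> 2 * (1 + b)\<close>. Then
  \<open>ln (1 + y) \<ge> y / 2\<close> and \<open>y \<ge> b * t^2 / 24\<close> give the constant 96
  = 4 * 24.\<close>

lemma norm_NB_gf_circle_le:
  fixes r b \<rho> t :: real
  assumes r: "0 < r" and b: "0 < b" "b \<le> 1 / 50" and rho: "1 / 2 \<le> \<rho>" "\<rho> \<le> 2"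
    and A: "0 < 1 + b - b * \<rho>" and t: "\<bar>t\<bar> \<le> pi"
  shows "norm (exp (- (r * Ln (1 - b * (\<rho> * cis t - 1))))) \<le>
    (1 + b - b * \<rho>) powr (- r) * exp (- (r * b * t\<^sup>2 / 96))"
proof -
  define A where "A = 1 + b - b * \<rho>"
  define c where "c = 1 - b * (\<rho> * cis t - 1)"
  define y where "y = b * \<rho> * (1 - cos t)"
  have A0: "0 < A" "A \<le> 1 + b" using assms by (auto simp: A_def)
  have cos1: "0 \<le> 1 - cos t" "1 - cos t \<le> 2" using cos_ge_minus_one[of t] by auto
  have "b * \<rho> \<le> (1 / 50) * 2" using b rho by (intro mult_mono) auto
  then have "y \<le> (1 / 50) * 2 * 2" unfolding y_def using cos1 b rho by (intro mult_mono) auto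
  then have y: "0 \<le> y" "y \<le> 1 / 2" using cos1 b rho by (auto simp: y_def)
  have "(norm c)\<^sup>2 = (Re c)\<^sup>2 + (Im c)\<^sup>2" by (rule cmod_power2)
  also have "Re c = 1 + b - b * \<rho> * cos t" by (simp add: c_def algebra_simps)
  also have "Im c = - (b * \<rho> * sin t)" by (simp add: c_def algebra_simps)
  also have "(- (b * \<rho> * sin t))\<^sup>2 = (b * \<rho>)\<^sup>2 - (b * \<rho> * cos t)\<^sup>2"
    by (simp add: power_mult_distrib sin_squared_eq right_diff_distrib)
  also have "(1 + b - b * \<rho> * cos t)\<^sup>2 + ((b * \<rho>)\<^sup>2 - (b * \<rho> * cos t)\<^sup>2) =
      A\<^sup>2 + 2 * (1 + b) * y"
    by (simp add: A_def y_def power2_eq_square algebra_simps)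
  finally have c2: "(norm c)\<^sup>2 = A\<^sup>2 + 2 * (1 + b) * y" .
  have "A\<^sup>2 \<le> (1 + b) * 2" unfolding power2_eq_square using A0 b by (intro mult_mono) auto
  then have "A\<^sup>2 * y \<le> 2 * (1 + b) * y" using y by (intro mult_right_mono) auto
  then have c_ge: "A\<^sup>2 * (1 + y) \<le> (norm c)\<^sup>2" unfolding c2 by (simp add: algebra_simps)
  moreover have pos: "0 < A\<^sup>2 * (1 + y)" using A0 y by simp
  ultimately have c0: "c \<noteq> 0" by auto
  have "y / 2 \<le> y - y\<^sup>2" using mult_left_mono[OF y(2,1)] by (simp add: power2_eq_square)
  also have "\<dots> \<le> ln (1 + y)" using y by (intro ln_one_plus_pos_lower_bound) auto
  finally have "2 * ln A + y / 2 \<le> 2 * ln A + ln (1 + y)" by simp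
  also have "\<dots> = ln (A\<^sup>2 * (1 + y))" using A0 y by (simp add: ln_mult ln_realpow)
  also have "\<dots> \<le> ln ((norm c)\<^sup>2)" using c_ge pos by (intro ln_mono) auto
  also have "\<dots> = 2 * ln (norm c)" using c0 by (simp add: ln_realpow)
  finally have ln_c: "ln A + y / 4 \<le> ln (norm c)" by simp
  have "b * (1 / 2) * (t\<^sup>2 / 12) \<le> y"
    unfolding y_def using b rho one_minus_cos_ge[OF t] by (intro mult_mono) auto
  then have "ln A + b * t\<^sup>2 / 96 \<le> ln (norm c)" using ln_c by simp
  then have "- (r * ln (norm c)) \<le> - (r * (ln A + b * t\<^sup>2 / 96))" using r by simp
  then have "exp (- (r * ln (norm c))) \<le> exp (- (r * (ln A + b * t\<^sup>2 / 96)))" by (subst exp_le_cancel_iff)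
  also have "\<dots> = A powr (- r) * exp (- (r * b * t\<^sup>2 / 96))"
    using A0 by (simp add: powr_def exp_add[symmetric] algebra_simps)
  finally show ?thesis using c0 by (simp add: A_def[symmetric] c_def[symmetric] Re_Ln)
qed

text \<open>With this \<open>\<rho>\<close>, the weights
  \<open>NB r (1 / (1 + b)) j * \<rho> ^ j\<close> divided by their total
  \<open>A powr (- r)\<close> form a negative binomial law with success ratio
  \<open>x / (r + x)\<close>, hence with mean \<open>x\<close>. The two Stirling-type bounds
  estimate its mass at the mean from below; the 2 in the denominator comes from
  \<open>r / (r + x) \<ge> 1/2\<close>.\<close>

lemma NB_ge:
  fixes r b :: real
  assumes r: "0 < r" "real x \<le> r" and b: "0 < b" and x: "0 < x"
    and rho: "\<rho> = x * (1 + b) / (b * (r + x))"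
  shows "(1 + b - b * \<rho>) powr (- r) / (2 * exp 1 * sqrt x) \<le> NB r (1 / (1 + b)) x * \<rho> ^ x"
proof -
  define A where "A = 1 + b - b * \<rho>"
  define P where "P = pochhammer r x / fact x"
  have A: "A = (1 + b) * (r / (r + x))" using assms by (simp add: A_def divide_simps) (simp add: algebra_simps)
  then have A0: "0 < A" using r b by simp
  have "1 / (1 + b) = (r / (r + x)) / A" using r b unfolding A by simp
  then have q: "(1 / (1 + b)) powr r = (r / (r + x)) powr r * A powr (- r)"
    using A0 r by (simp add: powr_divide powr_mult powr_minus_divide)
  have "1 - 1 / (1 + b) = b / (1 + b)" using b by (simp add: divide_simps)
  then have "(1 - 1 / (1 + b)) * \<rho> = x / (r + x)" using b by (simp add: rho)
  then have "(1 - 1 / (1 + b)) ^ x * \<rho> ^ x = (x / (r + x)) ^ x" by (simp flip: power_mult_distrib)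
  then have NB: "NB r (1 / (1 + b)) x * \<rho> ^ x = A powr (- r) * (P * (r / (r + x)) powr r * (x / (r + x)) ^ x)"
    unfolding NB_eq[OF r(1)] q P_def by (simp add: mult_ac)
  have "1 / (2 * exp 1 * sqrt x) \<le> P * (r / (r + x)) powr r * (x / (r + x)) ^ x"
  proof -
    let ?B = "(r + x) powr (r + x) / r powr r * exp (- real x)"
    let ?F = "exp (1 - real x) * sqrt x * real x ^ x"
    have "?B * (1 / 2) \<le> ?B * (r / (r + x))" using r by (intro mult_left_mono) (auto simp: divide_simps)
    also have "\<dots> \<le> pochhammer r x" by (rule pochhammer_ge[OF r(1)])
    finally have "?B * (1 / 2) / ?F \<le> P"
      unfolding P_def using r fact_le_stirling[OF x] by (intro frac_le) (auto intro: pochhammer_nonneg)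
    then have "?B * (1 / 2) / ?F * ((r / (r + x)) powr r * (x / (r + x)) ^ x) \<le>
       P * ((r / (r + x)) powr r * (x / (r + x)) ^ x)"
      using r by (intro mult_right_mono) auto
    moreover have "?B * (1 / 2) / ?F * ((r / (r + x)) powr r * (x / (r + x)) ^ x) = 1 / (2 * exp 1 * sqrt x)"
      using r x by (simp add: powr_divide powr_add powr_realpow power_divide exp_diff exp_minus field_simps)
    ultimately show ?thesis by (simp add: mult.assoc)
  qed
  then have "A powr (- r) * (1 / (2 * exp 1 * sqrt x)) \<le> NB r (1 / (1 + b)) x * \<rho> ^ x"
    unfolding NB by (intro mult_left_mono) auto
  then show ?thesis by (simp add: A_def)
qed

text \<open>The common expression in the parameters equals \<open>n * p^2 * b\<close>, so that
  \<open>b\<close> is the ratio of \<open>nb_pbar\<close> to \<open>nb_qbar\<close>.\<close>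

lemma nb_params_eq:
  fixes p :: real
  assumes "0 < p" "0 < n" and b: "b = p * (2 - 3 * p) - 2 * p * (1 - p) / n" "0 < b"
  shows "nb_qbar n p = 1 / (1 + b)" "nb_r n p = n * p\<^sup>2 / b"
proof -
  have D: "real n * p ^ 3 * (2 - 3 * p) - 2 * p ^ 3 * (1 - p) = n * p\<^sup>2 * b"
    unfolding b using assms(2) by (simp add: field_simps eval_nat_numeral)
  have "nb_pbar n p = b / (1 + b)"
  proof -
    have "nb_pbar n p = (n * p\<^sup>2 * b) / (n * p\<^sup>2 + n * p\<^sup>2 * b)"
      unfolding nb_pbar_def by (metis D add_diff_eq)
    also have "n * p\<^sup>2 + n * p\<^sup>2 * b = n * p\<^sup>2 * (1 + b)" by (simp add: algebra_simps)
    finally show ?thesis using assms by simp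
  qed
  then show "nb_qbar n p = 1 / (1 + b)" using b(2) by (simp add: nb_qbar_def field_simps)
  show "nb_r n p = n * p\<^sup>2 / b"
    unfolding nb_r_def D using assms by (simp add: eval_nat_numeral)
qed

section \<open>The local limit theorem\<close>

text \<open>Here \<open>t\<close> stands for \<open>\<mu>\<close> times the squared angle. Half of
  the exponential decay absorbs \<open>exp (m * t)\<close>; the other half is at most the inverse
  square of \<open>1 + t / 384\<close>. One of these two factors cancels the growth of
  \<open>E + m * t\<close>, the other remains as the integrable majorant.\<close>

lemma exp_decay_le:
  fixes E m t :: real
  assumes "0 \<le> E" "0 \<le> m" "0 \<le> t" "\<kappa> \<le> E + m * t" "0 \<le> \<kappa>" "m \<le> 1 / 192"
  shows "exp (- (t / 96)) * (\<kappa> * exp \<kappa>) \<le> (E + 384 * m) * exp E / (1 + t / 384)"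
proof -
  define y where "y = 1 + t / 384"
  have y: "0 < y" using assms by (simp add: y_def)
  have yy: "exp (- (t / 192)) \<le> 1 / (y * y)"
  proof -
    have "y * y \<le> exp (t / 384) * exp (t / 384)"
      using exp_ge_add_one_self[of "t / 384"] y by (intro mult_mono) (auto simp: y_def)
    also have "\<dots> = exp (t / 192)" unfolding exp_add[symmetric] by simp
    finally have "1 / exp (t / 192) \<le> 1 / (y * y)" using y by (intro divide_left_mono) auto
    then show ?thesis by (simp add: exp_minus inverse_eq_divide)
  qed
  have nonneg: "0 \<le> E + m * t" using assms by simp
  have "m * t \<le> t / 192" using mult_right_mono[OF assms(6,3)] by simp
  then have mt: "exp (- (t / 96) + m * t) \<le> exp (- (t / 192))" by simp
  have "\<kappa> * exp \<kappa> \<le> (E + m * t) * exp (E + m * t)"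
    using assms nonneg by (intro mult_mono) auto
  then have "exp (- (t / 96)) * (\<kappa> * exp \<kappa>) \<le> exp (- (t / 96)) * ((E + m * t) * exp (E + m * t))"
    by (intro mult_left_mono) auto
  also have "\<dots> = (E + m * t) * exp E * exp (- (t / 96) + m * t)"
    unfolding exp_add by (simp only: mult_ac)
  also have "\<dots> \<le> (E + m * t) * exp E * (1 / (y * y))"
    using order_trans[OF mt yy] nonneg by (intro mult_left_mono) auto
  also have "\<dots> \<le> ((E + 384 * m) * y) * exp E * (1 / (y * y))"
  proof -
    have "(E + 384 * m) * y = E + m * t + E * t / 384 + 384 * m"
      by (simp add: y_def algebra_simps)
    moreover have "0 \<le> E * t / 384" using assms by simp
    ultimately have "E + m * t \<le> (E + 384 * m) * y" using assms(2) by linarith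
    then show ?thesis using y by (intro mult_right_mono) auto
  qed
  also have "\<dots> = (E + 384 * m) * exp E / y" using y by simp
  finally show ?thesis by (simp only: y_def)
qed

lemma norm_circle_minus_1_le: "norm (\<rho> * cis t - 1) \<le> \<bar>\<rho> - 1\<bar> + \<bar>t\<bar>" for \<rho> :: real
proof -
  have "\<rho> * cis t - 1 = (\<rho> - 1) * cis t + (cis t - 1)" by (simp add: algebra_simps)
  then have "norm (\<rho> * cis t - 1) \<le> norm ((\<rho> - 1) * cis t) + norm (cis t - 1)"
    by (metis norm_triangle_ineq)
  also have "norm ((\<rho> - 1) * cis t) = \<bar>\<rho> - 1\<bar>" unfolding norm_mult norm_of_real by simp
  also have "norm (cis t - 1) \<le> \<bar>t\<bar>"
    using dist_exp_i_1[of t] abs_sin_x_le_abs_x[of "t / 2"] by (simp add: cis_conv_exp)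
  finally show ?thesis by simp
qed

text \<open>The explicit form of the limit theorem for fixed \<open>n\<close>: the coefficient
  estimate applied to the difference of both generating functions, divided by the lower bound for
  the tilted negative binomial mass.\<close>

lemma prob_S_NB_ratio_bound:
  fixes p :: real
  assumes p: "0 < p" "p \<le> 1 / 200" and n: "0 < n"
    and x: "n * p\<^sup>2 / 2 \<le> x" "x \<le> 2 * (n * p\<^sup>2)"
  defines "K \<equiv> 48 * \<bar>x - n * p\<^sup>2\<bar> ^ 3 / (n * p)\<^sup>2 + 80000 * p\<^sup>2"
  shows "\<bar>prob_S n p x / NB (nb_r n p) (nb_qbar n p) x - 1\<bar> \<le> 100 * K * exp K"
proof -
  define \<mu> where "\<mu> = n * p\<^sup>2"
  define b where "b = p * (2 - 3 * p) - 2 * p * (1 - p) / n"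
  define r where "r = \<mu> / b"
  \<comment> \<open>Chosen so that \<open>1 + \<delta>\<close> is the tilting radius required by
    \<open>NB_ge\<close>; see \<open>rho_eq\<close>.\<close>
  define \<delta> where "\<delta> = (x - \<mu>) / (\<mu> + b * x)"
  define \<rho> where "\<rho> = 1 + \<delta>"
  define A where "A = 1 + b - b * \<rho>"
  have lam: "0 < \<mu>" using p n by (simp add: \<mu>_def)
  have x': "\<mu> / 2 \<le> x" "x \<le> 2 * \<mu>" using x by (simp_all add: \<mu>_def)
  have x0: "0 < x" using lam x' by (cases x) auto
  have p2: "p\<^sup>2 \<le> p / 200" using mult_left_mono[OF p(2), of p] p by (simp add: power2_eq_square)
  \<comment> \<open>A positive integer \<open>x\<close> below \<open>2 * n * p^2\<close> excludes
    small \<open>n\<close>. From 4 on, the boundary term in \<open>b\<close> is at most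
    \<open>p / 2\<close>, which gives \<open>p \<le> b\<close>.\<close>
  have n4: "4 \<le> n"
  proof (rule ccontr)
    assume "\<not> 4 \<le> n"
    then have "n * p\<^sup>2 \<le> 4 * p\<^sup>2" by (intro mult_right_mono) auto
    then have "2 * \<mu> < 1" unfolding \<mu>_def using p2 p by linarith
    then show False using x' x0 by linarith
  qed
  have b: "p \<le> b" "b \<le> 2 * p"
  proof -
    define Y where "Y = 2 * p * (1 - p) / n"
    have Y: "0 \<le> Y" using p by (simp add: Y_def)
    have "Y \<le> 2 * p * 1 / 4" unfolding Y_def using p n4 by (intro frac_le mult_left_mono) auto
    moreover have "b = 2 * p - 3 * p\<^sup>2 - Y" by (simp add: b_def Y_def power2_eq_square right_diff_distrib)
    ultimately show "p \<le> b" "b \<le> 2 * p" using p2 p Y zero_le_power2[of p] by linarith+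
  qed
  then have b0: "0 < b" "b \<le> 1 / 100" using p by auto
  have par: "nb_qbar n p = 1 / (1 + b)" "nb_r n p = r"
    using nb_params_eq[OF p(1) n b_def b0(1)] by (simp_all add: r_def \<mu>_def)
  have rb: "r * b = n * p\<^sup>2" using b0 by (simp add: r_def \<mu>_def)
  have r0: "0 < r" using lam b0 by (simp add: r_def)
  have den: "\<mu> \<le> \<mu> + b * x" using b0 by simp
  have "\<mu> * 100 \<le> r"
  proof -
    have "\<mu> / (1 / 100) \<le> \<mu> / b" using lam b0 by (intro divide_left_mono) auto
    then show ?thesis by (simp add: r_def)
  qed
  then have xr: "x \<le> r" using x' lam by linarith
  have delta: "\<bar>\<delta>\<bar> \<le> \<bar>x - \<mu>\<bar> / \<mu>"
    unfolding \<delta>_def abs_divide using den lam by (intro frac_le) auto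
  have rho_eq: "\<rho> = x * (1 + b) / (b * (r + x))"
  proof -
    have "b * (r + x) = \<mu> + b * x" using b0 by (simp add: r_def distrib_left)
    moreover have "\<mu> + b * x \<noteq> 0" using den lam by linarith
    then have "\<rho> = ((\<mu> + b * x) + (x - \<mu>)) / (\<mu> + b * x)"
      by (simp only: \<rho>_def \<delta>_def add_divide_distrib[of "\<mu> + b * x"]) simp
    moreover have "(\<mu> + b * x) + (x - \<mu>) = x * (1 + b)" by (simp add: algebra_simps)
    ultimately show ?thesis by simp
  qed
  have rho: "1 / 2 \<le> \<rho>" "\<rho> \<le> 2"
  proof -
    have "(x - \<mu>) / (\<mu> + b * x) \<le> 1" using x' den lam by (simp add: divide_le_eq)
    then show "\<rho> \<le> 2" by (simp add: \<rho>_def \<delta>_def)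
    have "0 \<le> b * x" using b0 by simp
    then have "- (\<mu> + b * x) \<le> 2 * (x - \<mu>)" using x' by (simp add: algebra_simps)
    then have "- (1 / 2) \<le> (x - \<mu>) / (\<mu> + b * x)" using den lam by (simp add: le_divide_eq) argo
    then show "1 / 2 \<le> \<rho>" unfolding \<rho>_def \<delta>_def by linarith
  qed
  have "b * \<rho> \<le> (1 / 100) * 2" using b0 rho by (intro mult_mono) auto
  then have A: "0 < A" and brho: "\<rho> * b < 1 + b" using b0 by (auto simp: A_def mult.commute)

  define a where "a j = complex_of_real (prob_S n p j - NB r (1 / (1 + b)) j)" for j
  define G where "G z = exp (- (r * Ln (1 - b * (z - 1))))" for z :: complex
  define H where "H z = (\<Sum>j\<le>n. of_real (prob_S n p j) * z ^ j) - G z" for z :: complex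
  have a_sums: "(\<lambda>j. a j * z ^ j) sums H z" if "norm z = \<rho>" for z
  proof -
    have "(\<lambda>j. of_real (prob_S n p j) * z ^ j) sums (\<Sum>j\<le>n. of_real (prob_S n p j) * z ^ j)"
      by (rule sums_finite) (auto simp: prob_S_eq_0)
    moreover have "(\<lambda>j. of_real (NB r (1 / (1 + b)) j) * z ^ j) sums G z"
      unfolding G_def using that brho by (intro NB_gf_sums r0 b0) auto
    ultimately show ?thesis
      unfolding H_def a_def by (simp add: left_diff_distrib sums_diff)
  qed
  have a_summable: "summable (\<lambda>j. norm (a j) * \<rho> ^ j)"
  proof -
    \<comment> \<open>The terms are nonnegative, so convergence at the positive real point
      \<open>\<rho>\<close> is already absolute convergence.\<close>
    have "summable (\<lambda>j. NB r (1 / (1 + b)) j * \<rho> ^ j)"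
    proof -
      have "(\<lambda>j. of_real (NB r (1 / (1 + b)) j) * of_real \<rho> ^ j) sums G \<rho>"
        unfolding G_def using rho brho by (intro NB_gf_sums r0 b0) auto
      then have "summable (\<lambda>j. complex_of_real (NB r (1 / (1 + b)) j * \<rho> ^ j))"
        by (simp add: sums_iff)
      then show ?thesis by (simp only: summable_of_real_iff)
    qed
    moreover have "summable (\<lambda>j. prob_S n p j * \<rho> ^ j)"
      by (rule summable_finite[of "{..n}"]) (auto simp: prob_S_eq_0)
    ultimately have sum: "summable (\<lambda>j. prob_S n p j * \<rho> ^ j + NB r (1 / (1 + b)) j * \<rho> ^ j)"
      by (rule summable_add[rotated])
    have "norm (a j) \<le> prob_S n p j + NB r (1 / (1 + b)) j" for j
    proof -
      have "0 \<le> prob_S n p j" by (simp add: prob_S_def)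
      moreover have "0 \<le> NB r (1 / (1 + b)) j"
        using r0 b0 by (auto simp: NB_eq pochhammer_nonneg)
      ultimately show ?thesis unfolding a_def norm_of_real by linarith
    qed
    then show ?thesis
      using rho by (intro summable_comparison_test'[OF sum, of 0])
        (auto simp: abs_mult simp flip: distrib_right intro!: mult_right_mono)
  qed

  \<comment> \<open>\<open>\<kappa>\<close> splits into a part \<open>E\<close> constant on the
    circle and a part \<open>m * \<mu> * t^2\<close>. The cube of
    \<open>\<bar>\<delta>\<bar> + \<bar>t\<bar>\<close> costs a factor 4, and
    \<open>\<bar>t\<bar>\<close> below 4 turns the cube of \<open>\<bar>t\<bar>\<close> into
    \<open>4 * t^2\<close>; thus 48 = 12 * 4 and 192 = 12 * 16.\<close>
  define E where "E = 48 * real n * p ^ 4 * \<bar>\<delta>\<bar> ^ 3 + 300 * p ^ 3"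
  define m where "m = 192 * p\<^sup>2"
  define M where "M = A powr (- r) * ((E + 384 * m) * exp E)"
  have H_le: "norm (H (\<rho> * cis t)) \<le> M * (1 / (1 + \<mu> / 384 * t\<^sup>2))" if t: "t \<in> {-pi..pi}" for t
  proof -
    define u where "u = \<rho> * cis t - 1"
    define \<kappa> where "\<kappa> = 12 * real n * p ^ 4 * norm u ^ 3 + 300 * p ^ 3"
    have t': "\<bar>t\<bar> \<le> pi" using t by auto
    have u3: "norm u \<le> 3"
      unfolding u_def using norm_triangle_ineq4[of "\<rho> * cis t" 1] rho by (simp add: norm_mult)
    have "norm (H (1 + u)) \<le> norm (G (1 + u)) * (\<kappa> * exp \<kappa>)"
      unfolding H_def G_def using gf_S_xi_approx[OF p(1) _ u3 n b0(1) b(2) b_def rb \<kappa>_def] p by simp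
    also have "norm (G (1 + u)) \<le> A powr (- r) * exp (- (r * b * t\<^sup>2 / 96))"
      unfolding G_def u_def A_def
      using norm_NB_gf_circle_le[OF r0 b0(1) _ rho _ t'] b0 A by (simp add: A_def)
    finally have "norm (H (1 + u)) \<le> A powr (- r) * exp (- (\<mu> * t\<^sup>2 / 96)) * (\<kappa> * exp \<kappa>)"
      using p by (simp add: \<kappa>_def mult_right_mono rb \<mu>_def)
    also have "\<dots> \<le> A powr (- r) * ((E + 384 * m) * exp E / (1 + \<mu> * t\<^sup>2 / 384))"
    proof -
      have "norm u ^ 3 \<le> 4 * \<bar>\<delta>\<bar> ^ 3 + 16 * t\<^sup>2"
      proof -
        have "norm u ^ 3 \<le> (\<bar>\<delta>\<bar> + \<bar>t\<bar>) ^ 3"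
          using norm_circle_minus_1_le[of \<rho> t] by (intro power_mono) (auto simp: u_def \<rho>_def)
        also have "\<dots> \<le> 4 * \<bar>\<delta>\<bar> ^ 3 + 4 * \<bar>t\<bar> ^ 3"
        proof -
          have "0 \<le> 3 * (\<bar>\<delta>\<bar> + \<bar>t\<bar>) * (\<bar>\<delta>\<bar> - \<bar>t\<bar>)\<^sup>2" by simp
          also have "\<dots> = 4 * \<bar>\<delta>\<bar> ^ 3 + 4 * \<bar>t\<bar> ^ 3 - (\<bar>\<delta>\<bar> + \<bar>t\<bar>) ^ 3"
            by (simp add: eval_nat_numeral algebra_simps)
          finally show ?thesis by simp
        qed
        also have "\<bar>t\<bar> ^ 3 \<le> 4 * t\<^sup>2"
          using mult_right_mono[of "\<bar>t\<bar>" 4 "t\<^sup>2"] t' pi_less_4 by (simp add: eval_nat_numeral)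
        finally show ?thesis by simp
      qed
      then have "12 * real n * p ^ 4 * norm u ^ 3 \<le> 12 * real n * p ^ 4 * (4 * \<bar>\<delta>\<bar> ^ 3 + 16 * t\<^sup>2)"
        using p by (intro mult_left_mono) auto
      then have "\<kappa> \<le> E + m * (\<mu> * t\<^sup>2)"
        by (simp add: \<kappa>_def E_def m_def \<mu>_def algebra_simps eval_nat_numeral)
      moreover have "m \<le> 1 / 192"
      proof -
        have "p\<^sup>2 \<le> (1 / 200)\<^sup>2" using p by (intro power_mono) auto
        then show ?thesis by (simp add: m_def power2_eq_square)
      qed
      ultimately have "exp (- (\<mu> * t\<^sup>2 / 96)) * (\<kappa> * exp \<kappa>) \<le> (E + 384 * m) * exp E / (1 + \<mu> * t\<^sup>2 / 384)"
        using p lam by (intro exp_decay_le) (auto simp: E_def m_def \<kappa>_def)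
      then show ?thesis unfolding mult.assoc by (intro mult_left_mono) auto
    qed
    finally show ?thesis by (simp add: M_def u_def)
  qed

  obtain I where I: "((\<lambda>t. 1 / (1 + \<mu> / 384 * t\<^sup>2)) has_integral I) {-pi..pi}" "I \<le> pi / sqrt (\<mu> / 384)"
    using integral_inverse_quadratic[of "\<mu> / 384"] lam by auto
  have M0: "0 \<le> M" using p by (simp add: M_def E_def m_def)
  have "norm (a x) * \<rho> ^ x \<le> M * I / (2 * pi)"
    by (rule power_series_coeff_bound[OF _ a_summable a_sums H_le has_integral_mult_right[OF I(1)]])
       (use rho in auto)
  also have "\<dots> \<le> M * (pi / sqrt (\<mu> / 384)) / (2 * pi)"
    using I(2) M0 by (intro divide_right_mono mult_left_mono) auto
  also have "\<dots> = M * (sqrt 384 / 2) / sqrt \<mu>" by (simp add: real_sqrt_divide)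
  also have "\<dots> \<le> M * 10 / sqrt \<mu>"
  proof -
    have "sqrt 384 \<le> 20" by (rule real_le_lsqrt) auto
    then show ?thesis using M0 lam by (intro divide_right_mono mult_left_mono) auto
  qed
  finally have diff: "norm (a x) * \<rho> ^ x \<le> M * 10 / sqrt \<mu>" .

  define N where "N = NB r (1 / (1 + b)) x"
  have N_ge: "A powr (- r) / (2 * exp 1 * sqrt x) \<le> N * \<rho> ^ x"
    unfolding A_def N_def by (rule NB_ge[OF r0 xr b0(1) x0 rho_eq])
  have "0 < A powr (- r) / (2 * exp 1 * sqrt x)" using A x0 by simp
  then have "0 < N * \<rho> ^ x" using N_ge by linarith
  then have N0: "0 < N" using rho by (simp add: zero_less_mult_iff)
  \<comment> \<open>Since \<open>n * p^4 / \<mu>^3 = 1 / (n * p)^2\<close>, the cubic term takes its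
    final form; \<open>384 * 192 + 2\<close> is below 80000.\<close>
  have EK: "E + 384 * m \<le> K"
  proof -
    have "n * p ^ 4 * \<bar>\<delta>\<bar> ^ 3 \<le> n * p ^ 4 * (\<bar>x - \<mu>\<bar> / \<mu>) ^ 3"
      using delta by (intro mult_left_mono power_mono) auto
    also have "\<dots> = \<bar>x - \<mu>\<bar> ^ 3 / (n * p)\<^sup>2"
      using p n by (simp add: \<mu>_def power_divide power_mult_distrib divide_simps) (simp add: eval_nat_numeral)
    finally have "48 * real n * p ^ 4 * \<bar>\<delta>\<bar> ^ 3 \<le> 48 * \<bar>x - n * p\<^sup>2\<bar> ^ 3 / (n * p)\<^sup>2" by (simp add: \<mu>_def)
    moreover have "300 * p ^ 3 \<le> 2 * p\<^sup>2"
    proof -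
      have "p ^ 3 = p * p\<^sup>2" by (simp add: eval_nat_numeral)
      also have "\<dots> \<le> 1 / 200 * p\<^sup>2" using p by (intro mult_right_mono) auto
      finally show ?thesis using zero_le_power2[of p] by linarith
    qed
    moreover have "0 \<le> p\<^sup>2" by simp
    ultimately show ?thesis unfolding E_def m_def K_def by linarith
  qed
  have E0: "0 \<le> E" "0 \<le> m" using p by (auto simp: E_def m_def)
  have "M \<le> A powr (- r) * (K * exp K)"
    unfolding M_def using EK E0 by (intro mult_left_mono mult_mono) auto
  then have "M * 10 / sqrt \<mu> \<le> (A powr (- r) * (K * exp K)) * 10 / sqrt \<mu>"
    using lam by (intro divide_right_mono mult_right_mono) auto
  \<comment> \<open>Both bounds carry \<open>A powr (- r)\<close> and a reciprocal square root of
    order \<open>\<mu>\<close>, so these cancel in the ratio. The remaining constant is at most 20 *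
    3 * 3/2 = 90.\<close>
  also have "\<dots> = A powr (- r) / (2 * exp 1 * sqrt x) * (20 * exp 1 * (sqrt x / sqrt \<mu>) * (K * exp K))"
    using x0 lam by (simp add: field_simps)
  also have "\<dots> \<le> (N * \<rho> ^ x) * (100 * (K * exp K))"
  proof (intro mult_mono N_ge)
    have "sqrt x \<le> sqrt (2 * \<mu>)" using x' by simp
    also have "\<dots> = sqrt 2 * sqrt \<mu>" by (rule real_sqrt_mult)
    also have "\<dots> \<le> (3 / 2) * sqrt \<mu>" using lam by (intro mult_right_mono real_le_lsqrt) (auto simp: power2_eq_square)
    finally have "sqrt x / sqrt \<mu> \<le> 3 / 2" using lam by (simp add: field_simps)
    then have "exp 1 * (sqrt x / sqrt \<mu>) \<le> 3 * (3 / 2)" using exp_le lam by (intro mult_mono) auto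
    then show "20 * exp 1 * (sqrt x / sqrt \<mu>) \<le> 100" by simp
  qed (use EK E0 N0 rho lam in auto)
  finally have "norm (a x) * \<rho> ^ x \<le> (N * (100 * (K * exp K))) * \<rho> ^ x"
    using diff by (simp add: mult_ac)
  then have "norm (a x) \<le> N * (100 * (K * exp K))"
    by (rule mult_right_le_imp_le) (use rho in simp)
  then have "\<bar>prob_S n p x - N\<bar> \<le> N * (100 * (K * exp K))"
    unfolding a_def N_def norm_of_real .
  then have "\<bar>prob_S n p x - N\<bar> / N \<le> 100 * (K * exp K)" using N0 by (simp add: divide_le_eq mult.commute)
  moreover have "prob_S n p x / N - 1 = (prob_S n p x - N) / N" using N0 by (simp add: diff_divide_distrib)
  ultimately show ?thesis using N0 unfolding par N_def[symmetric] by (simp add: abs_divide)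
qed

theorem theorem3:
  fixes p :: "nat \<Rightarrow> real" and x :: "nat \<Rightarrow> nat"
  assumes "\<And>n. 0 < p n \<and> p n < 1"
    and "p \<longlonglongrightarrow> 0"
    and "filterlim (\<lambda>n. real n * p n) at_top sequentially"
    and "(\<lambda>n. \<bar>real (x n) - real n * (p n)^2\<bar>) \<in>
           o(\<lambda>n. min (real n * (p n)^2) (real n powr (2/3) * p n powr (2/3)))"
  shows "(\<lambda>n. prob_S n (p n) (x n) / NB (nb_r n (p n)) (nb_qbar n (p n)) (x n))
           \<longlonglongrightarrow> 1"
proof -
  define d where "d n = \<bar>real (x n) - real n * (p n)^2\<bar>" for n
  define g where "g n = min (real n * (p n)^2) (real n powr (2/3) * p n powr (2/3))" for n
  define K where "K n = 48 * d n ^ 3 / (n * p n)\<^sup>2 + 80000 * (p n)\<^sup>2" for n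
  have small: "d \<in> o(g)" using assms(4) by (simp add: d_def[abs_def] g_def[abs_def])
  have g: "0 < g n" "g n \<le> n * (p n)\<^sup>2" "g n ^ 3 \<le> (n * p n)\<^sup>2" if "0 < n" for n
  proof -
    have p: "0 < p n" using assms(1) by blast
    show g0: "0 < g n" using p that by (simp add: g_def)
    show "g n \<le> n * (p n)\<^sup>2" by (simp add: g_def)
    \<comment> \<open>The second entry of the minimum is made for the cubic error term: its cube is
      exactly the denominator in \<open>K\<close>.\<close>
    have "g n ^ 3 \<le> (real n powr (2/3) * p n powr (2/3)) ^ 3"
      using g0 by (intro power_mono) (auto simp: g_def)
    also have "\<dots> = (n * p n)\<^sup>2"
      using p that by (simp add: power_mult_distrib powr_power powr_numeral)
    finally show "g n ^ 3 \<le> (n * p n)\<^sup>2" .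
  qed
  have "(\<lambda>n. (d n / g n) ^ 3) \<longlonglongrightarrow> 0 ^ 3"
    by (intro tendsto_power smalloD_tendsto[OF small])
  then have cube: "(\<lambda>n. (d n / g n) ^ 3) \<longlonglongrightarrow> 0" by simp
  have "(\<lambda>n. d n ^ 3 / (n * p n)\<^sup>2) \<longlonglongrightarrow> 0"
  proof (rule tendsto_sandwich[OF _ _ tendsto_const cube])
    show "eventually (\<lambda>n. d n ^ 3 / (n * p n)\<^sup>2 \<le> (d n / g n) ^ 3) sequentially"
      using eventually_gt_at_top[of 0]
    proof eventually_elim
      case (elim n)
      have "d n ^ 3 / (n * p n)\<^sup>2 \<le> d n ^ 3 / g n ^ 3"
        using g[OF elim] assms(1)[of n] elim by (intro divide_left_mono) (auto simp: d_def)
      then show ?case by (simp add: power_divide)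
    qed
  qed (simp add: d_def)
  then have "(\<lambda>n. 48 * (d n ^ 3 / (n * p n)\<^sup>2) + 80000 * (p n)\<^sup>2) \<longlonglongrightarrow> 48 * 0 + 80000 * 0\<^sup>2"
    by (intro tendsto_intros assms(2))
  then have K: "K \<longlonglongrightarrow> 0" by (simp add: K_def[abs_def])
  have "(\<lambda>n. 100 * K n * exp (K n)) \<longlonglongrightarrow> 100 * 0 * exp 0"
    by (intro tendsto_intros K)
  then have lim: "(\<lambda>n. 100 * K n * exp (K n)) \<longlonglongrightarrow> 0" by simp
  have "eventually (\<lambda>n. p n < 1 / 200) sequentially"
    by (rule order_tendstoD(2)[OF assms(2)]) simp
  \<comment> \<open>The first entry of the minimum, with little-o constant \<open>1 / 2\<close>,
    puts \<open>x n\<close> into the window that the explicit bound demands.\<close>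
  moreover have "eventually (\<lambda>n. norm (d n) \<le> 1 / 2 * norm (g n)) sequentially"
    by (rule landau_o.smallD[OF small]) simp
  ultimately have "eventually (\<lambda>n. norm (prob_S n (p n) (x n) / NB (nb_r n (p n)) (nb_qbar n (p n)) (x n) - 1)
     \<le> 100 * K n * exp (K n)) sequentially"
    using eventually_gt_at_top[of 0]
  proof eventually_elim
    case (elim n)
    have "d n \<le> n * (p n)\<^sup>2 / 2" using elim(2) g[OF elim(3)] by (simp add: d_def)
    then have "n * (p n)\<^sup>2 / 2 \<le> x n" "x n \<le> 2 * (n * (p n)\<^sup>2)" unfolding d_def by linarith+
    then show ?case
      using prob_S_NB_ratio_bound[of "p n" n "x n"] assms(1)[of n] elim by (simp add: K_def d_def)
  qed
  then have "(\<lambda>n. prob_S n (p n) (x n) / NB (nb_r n (p n)) (nb_qbar n (p n)) (x n) - 1) \<longlonglongrightarrow> 0"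
    by (rule Lim_null_comparison[OF _ lim])
  then show ?thesis by (simp add: LIM_zero_iff)
qed

end
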